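(* Let $\alpha$ be a unit speed spacelike curve in $\mathbf{E}_1^3$ with timelike binormal, curvature $\kappa$ and torsion $\tau$, and with spacelike Darboux vector $\omega=\tau t-\kappa b$ (i.e. $|\kappa|<|\tau|$). Let $\alpha^*$ be an involute of $\alpha$ and let $\alpha^*_{b^*}=b^*$ be its binormal spherical indicatrix. Then $\alpha^*_{b^*}$ cannot be a geodesic line on the Lorentzian sphere $S_1^2$, because the evolute curve $\alpha$ would then have curvature and torsion equal to $0$ and so be a straight line, in which case $(\alpha,\alpha^* )$ cannot be an involute-evolute curve couple. Therefore the natural lift $\overline{\alpha^*}_{b^*}$ of $\alpha^*_{b^*}$ can never be an integral curve of the geodesic spray on the tangent bundle $T(S_1^2)$. If instead $\omega$ is timelike (i.e. $|\kappa|>|\tau|$), the similar result holds with the hyperbolic sphere $H_0^2$ in place of $S_1^2$.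
   Context: $\mathbf{E}_1^3$ is $\mathbb{R}^3$ with the metric $g=-dx_1^2+dx_2^2+dx_3^2$; $D$ is its standard flat connection, and $\|a\|=\sqrt{|g(a,a)|}$. A vector $v$ is spacelike if $g(v,v)>0$ or $v=0$, and timelike if $g(v,v)<0$. $S_1^2=\{a: g(a,a)=1\}$ is the Lorentzian unit sphere and $H_0^2=\{a: g(a,a)=-1\}$ is the hyperbolic unit sphere. A unit speed spacelike curve $\alpha$ with timelike binormal has a Frenet frame $\{t,n,b\}$ of mutually orthogonal vectors along $\alpha$ with $t=\alpha'$, $g(t,t)=g(n,n)=1$, $g(b,b)=-1$, satisfying $t'=\kappa n$, $n'=-\kappa t+\tau b$, $b'=\tau n$. The function $\theta$ along $\alpha$ is defined as follows. If $\omega$ is spacelike: $\kappa=\|\omega\|\sinh\theta$, $\tau=\|\omega\|\cosh\theta$, with $\|\omega\|^2=\tau^2-\kappa^2$. If $\omega$ is timelike: $\kappa=\|\omega\|\cosh\theta$, $\tau=\|\omega\|\sinh\theta$, with $\|\omega\|^2=\kappa^2-\tau^2$. An involute of $\alpha$ is a curve $\alpha^*(s)=\alpha(s)+(c-s)t(s)$, where $c$ is a real constant; $(\alpha,\alpha^* )$ is then called an involute-evolute curve couple, with $\alpha$ the evolute. The Frenet vectors of $\alpha^*$ used here satisfy: if $\omega$ is spacelike, $t^*=n$, $n^*=\sinh\theta\,t-\cosh\theta\,b$, $b^*=-\cosh\theta\,t+\sinh\theta\,b$ (so $b^*$ is spacelike); if $\omega$ is timelike, $t^*=n$, $n^*=-\cosh\theta\,t+\sinh\theta\,b$,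 $b^*=-\sinh\theta\,t+\cosh\theta\,b$ (so $b^*$ is timelike). The binormal spherical indicatrix of $\alpha^*$ is the curve traced on $S_1^2$ (respectively $H_0^2$) by the vector $b^*$ translated to the origin. Let $M$ be a nondegenerate hypersurface of $\mathbf{E}_1^3$ with unit normal field $\xi$, $\varepsilon=g(\xi,\xi)$, and shape operator $S(v)=-D_v\xi$. The natural lift of a curve $\beta$ on $M$ is the curve $\overline\beta(s)=(\beta(s),\beta'(s))=\beta'(s)|_{\beta(s)}$ in $TM$, and one writes $\frac{d\overline\beta}{ds}=D_{\beta'}\beta'$. The geodesic spray is $X(v)=\varepsilon\, g(v,S(v))\,\xi$ (with $\xi$ evaluated at the base point of $v\in TM$). The natural lift $\overline\beta$ is an integral curve of $X$ if $D_{\beta'}\beta'=X(\beta')$ along $\beta$. A curve $\beta$ on $M$ is a geodesic if the covariant derivative of $\beta'$ along $\beta$ for the induced connection of $M$ vanishes.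
   Formalization: The binormal indicatrix is assumed not to reduce to a point (for a helix it is constant, so trivially a geodesic with integral natural lift), and an involute is required not to reduce to a point (otherwise a straight line would have involutes). *)

theory Defs
  imports "HOL-Analysis.Analysis"
begin

section \<open>Minkowski 3-space\<close>

definition lorentz :: "real^3 \<Rightarrow> real^3 \<Rightarrow> real" where
  "lorentz x y = - (x$1 * y$1) + x$2 * y$2 + x$3 * y$3"

definition lorentz_norm :: "real^3 \<Rightarrow> real" where
  "lorentz_norm x = sqrt \<bar>lorentz x x\<bar>"

definition spacelike :: "real^3 \<Rightarrow> bool" where
  "spacelike v \<longleftrightarrow> lorentz v v > 0 \<or> v = 0"

definition timelike :: "real^3 \<Rightarrow> bool" where
  "timelike v \<longleftrightarrow> lorentz v v < 0"

definition lorentzian_sphere :: "(real^3) set" where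
  "lorentzian_sphere = {a. lorentz a a = 1}"

definition hyperbolic_sphere :: "(real^3) set" where
  "hyperbolic_sphere = {a. lorentz a a = -1}"

section \<open>Smooth curves and their parametrizations\<close>

abbreviation velocity :: "(real \<Rightarrow> 'a::real_normed_vector) \<Rightarrow> real \<Rightarrow> 'a" where
  "velocity \<gamma> \<equiv> \<lambda>s. vector_derivative \<gamma> (at s)"

abbreviation acceleration :: "(real \<Rightarrow> 'a::real_normed_vector) \<Rightarrow> real \<Rightarrow> 'a" where
  "acceleration \<gamma> \<equiv> velocity (velocity \<gamma>)"

definition open_interval :: "real set \<Rightarrow> bool" where
  "open_interval I \<longleftrightarrow> open I \<and> is_interval I \<and> I \<noteq> {}"

definition smooth_curve_on :: "real set \<Rightarrow> (real \<Rightarrow> 'a::real_normed_vector) \<Rightarrow> bool" where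
  "smooth_curve_on I \<gamma> \<longleftrightarrow> (\<forall>k. \<forall>s\<in>I. (velocity ^^ k) \<gamma> differentiable (at s))"

definition regular_on :: "real set \<Rightarrow> (real \<Rightarrow> 'a::real_normed_vector) \<Rightarrow> bool" where
  "regular_on I \<gamma> \<longleftrightarrow> (\<forall>s\<in>I. velocity \<gamma> s \<noteq> 0)"

text \<open>\<open>\<beta>\<close> on \<open>J\<close> is a reparametrization of \<open>\<gamma>\<close> on \<open>I\<close>. The choices \<open>J = I\<close>, \<open>\<beta> = \<gamma>\<close> and,
  where it exists, the parametrization of \<open>\<gamma>\<close> by its own arc length are instances.\<close>

definition reparametrizes ::
  "real set \<Rightarrow> (real \<Rightarrow> 'a) \<Rightarrow> real set \<Rightarrow> (real \<Rightarrow> 'a) \<Rightarrow> bool" where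
  "reparametrizes J \<beta> I \<gamma> \<longleftrightarrow> open_interval J \<and>
     (\<exists>\<phi> :: real \<Rightarrow> real. smooth_curve_on J \<phi> \<and> regular_on J \<phi> \<and> \<phi> ` J = I \<and> (\<forall>u\<in>J. \<beta> u = \<gamma> (\<phi> u)))"

section \<open>Frenet frames, Darboux vector, involutes\<close>

text \<open>Unit speed is the condition \<open>lorentz (t s) (t s) = 1\<close>.\<close>

definition frenet_timelike_binormal ::
  "real set \<Rightarrow> (real \<Rightarrow> real^3) \<Rightarrow> (real \<Rightarrow> real^3) \<Rightarrow> (real \<Rightarrow> real^3) \<Rightarrow> (real \<Rightarrow> real^3)
     \<Rightarrow> (real \<Rightarrow> real) \<Rightarrow> (real \<Rightarrow> real) \<Rightarrow> bool" where
  "frenet_timelike_binormal I \<alpha> t n b \<kappa> \<tau> \<longleftrightarrow>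
     open_interval I \<and>
     smooth_curve_on I \<alpha> \<and> smooth_curve_on I t \<and> smooth_curve_on I n \<and> smooth_curve_on I b \<and>
     smooth_curve_on I \<kappa> \<and> smooth_curve_on I \<tau> \<and>
     (\<forall>s\<in>I.
        lorentz (t s) (t s) = 1 \<and> lorentz (n s) (n s) = 1 \<and> lorentz (b s) (b s) = -1 \<and>
        lorentz (t s) (n s) = 0 \<and> lorentz (t s) (b s) = 0 \<and> lorentz (n s) (b s) = 0 \<and>
        velocity \<alpha> s = t s \<and>
        velocity t s = \<kappa> s *\<^sub>R n s \<and>
        velocity n s = - \<kappa> s *\<^sub>R t s + \<tau> s *\<^sub>R b s \<and>
        velocity b s = \<tau> s *\<^sub>R n s)"

definition darboux ::
  "(real \<Rightarrow> real^3) \<Rightarrow> (real \<Rightarrow> real^3) \<Rightarrow> (real \<Rightarrow> real) \<Rightarrow> (real \<Rightarrow> real) \<Rightarrow> real \<Rightarrow> real^3" where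
  "darboux t b \<kappa> \<tau> s = \<tau> s *\<^sub>R t s - \<kappa> s *\<^sub>R b s"

definition angle_spacelike_darboux ::
  "real set \<Rightarrow> (real \<Rightarrow> real^3) \<Rightarrow> (real \<Rightarrow> real) \<Rightarrow> (real \<Rightarrow> real) \<Rightarrow> (real \<Rightarrow> real) \<Rightarrow> bool" where
  "angle_spacelike_darboux I \<omega> \<kappa> \<tau> \<theta> \<longleftrightarrow> smooth_curve_on I \<theta> \<and>
     (\<forall>s\<in>I. \<kappa> s = lorentz_norm (\<omega> s) * sinh (\<theta> s) \<and> \<tau> s = lorentz_norm (\<omega> s) * cosh (\<theta> s))"

definition angle_timelike_darboux ::
  "real set \<Rightarrow> (real \<Rightarrow> real^3) \<Rightarrow> (real \<Rightarrow> real) \<Rightarrow> (real \<Rightarrow> real) \<Rightarrow> (real \<Rightarrow> real) \<Rightarrow> bool" where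
  "angle_timelike_darboux I \<omega> \<kappa> \<tau> \<theta> \<longleftrightarrow> smooth_curve_on I \<theta> \<and>
     (\<forall>s\<in>I. \<kappa> s = lorentz_norm (\<omega> s) * cosh (\<theta> s) \<and> \<tau> s = lorentz_norm (\<omega> s) * sinh (\<theta> s))"

text \<open>An involute has to be a genuine curve, i.e. it must not reduce to a single point; this is
  what excludes straight lines as evolutes.\<close>

definition involute_evolute_couple ::
  "real set \<Rightarrow> (real \<Rightarrow> real^3) \<Rightarrow> (real \<Rightarrow> real^3) \<Rightarrow> bool" where
  "involute_evolute_couple I \<alpha> \<alpha>s \<longleftrightarrow>
     (\<exists>c. \<forall>s\<in>I. \<alpha>s s = \<alpha> s + (c - s) *\<^sub>R velocity \<alpha> s) \<and> \<not> \<alpha>s constant_on I"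

text \<open>The binormal \<open>b\<^sup>*\<close> of an involute, in the Frenet frame \<open>t, n, b\<close> of the evolute. Since
  \<open>\<alpha>\<^sup>*' = (c - s) \<kappa> n\<close>, it is the common normal direction of \<open>n\<close> and \<open>n'\<close>; see the
  orthogonality lemmas below.\<close>

definition involute_binormal_spacelike_darboux ::
  "(real \<Rightarrow> real) \<Rightarrow> (real \<Rightarrow> real^3) \<Rightarrow> (real \<Rightarrow> real^3) \<Rightarrow> real \<Rightarrow> real^3" where
  "involute_binormal_spacelike_darboux \<theta> t b s = - cosh (\<theta> s) *\<^sub>R t s + sinh (\<theta> s) *\<^sub>R b s"

definition involute_binormal_timelike_darboux ::
  "(real \<Rightarrow> real) \<Rightarrow> (real \<Rightarrow> real^3) \<Rightarrow> (real \<Rightarrow> real^3) \<Rightarrow> real \<Rightarrow> real^3" where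
  "involute_binormal_timelike_darboux \<theta> t b s = - sinh (\<theta> s) *\<^sub>R t s + cosh (\<theta> s) *\<^sub>R b s"

section \<open>Hypersurfaces, geodesics and the geodesic spray\<close>

text \<open>A hypersurface is given as a set together with (an extension to the ambient space of) a
  unit normal field \<open>\<xi>\<close>. Tangent vectors are velocities of curves in the hypersurface.\<close>

definition unit_normal_field :: "(real^3) set \<Rightarrow> (real^3 \<Rightarrow> real^3) \<Rightarrow> bool" where
  "unit_normal_field M \<xi> \<longleftrightarrow>
     (\<forall>p\<in>M. \<bar>lorentz (\<xi> p) (\<xi> p)\<bar> = 1) \<and>
     (\<forall>J \<gamma>. open_interval J \<and> smooth_curve_on J \<gamma> \<and> \<gamma> ` J \<subseteq> M \<longrightarrow>
        (\<forall>s\<in>J. lorentz (\<xi> (\<gamma> s)) (velocity \<gamma> s) = 0))"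

definition shape_operator :: "(real^3 \<Rightarrow> real^3) \<Rightarrow> real^3 \<Rightarrow> real^3 \<Rightarrow> real^3" where
  "shape_operator \<xi> p v = - frechet_derivative \<xi> (at p) v"

definition geodesic_spray :: "(real^3 \<Rightarrow> real^3) \<Rightarrow> (real^3) \<times> (real^3) \<Rightarrow> real^3" where
  "geodesic_spray \<xi> = (\<lambda>(p, v).
     (lorentz (\<xi> p) (\<xi> p) * lorentz v (shape_operator \<xi> p v)) *\<^sub>R \<xi> p)"

definition natural_lift :: "(real \<Rightarrow> real^3) \<Rightarrow> real \<Rightarrow> (real^3) \<times> (real^3)" where
  "natural_lift \<beta> u = (\<beta> u, velocity \<beta> u)"

text \<open>The flat connection gives \<open>D\<^bsub>\<beta>'\<^esub> \<beta>' = \<beta>''\<close>, which by convention is the derivative of the natural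
  lift.\<close>

definition natural_lift_is_integral_curve ::
  "(real^3) set \<Rightarrow> (real^3 \<Rightarrow> real^3) \<Rightarrow> real set \<Rightarrow> (real \<Rightarrow> real^3) \<Rightarrow> bool" where
  "natural_lift_is_integral_curve M \<xi> J \<beta> \<longleftrightarrow> \<beta> ` J \<subseteq> M \<and>
     (\<forall>u\<in>J. acceleration \<beta> u = geodesic_spray \<xi> (natural_lift \<beta> u))"

text \<open>The induced connection is the tangential part of the flat one.\<close>

definition covariant_acceleration ::
  "(real^3 \<Rightarrow> real^3) \<Rightarrow> (real \<Rightarrow> real^3) \<Rightarrow> real \<Rightarrow> real^3" where
  "covariant_acceleration \<xi> \<beta> u = acceleration \<beta> u -
     (lorentz (\<xi> (\<beta> u)) (\<xi> (\<beta> u)) * lorentz (acceleration \<beta> u) (\<xi> (\<beta> u))) *\<^sub>R \<xi> (\<beta> u)"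

definition geodesic_on ::
  "(real^3) set \<Rightarrow> (real^3 \<Rightarrow> real^3) \<Rightarrow> real set \<Rightarrow> (real \<Rightarrow> real^3) \<Rightarrow> bool" where
  "geodesic_on M \<xi> J \<beta> \<longleftrightarrow> \<beta> ` J \<subseteq> M \<and> (\<forall>u\<in>J. covariant_acceleration \<xi> \<beta> u = 0)"

text \<open>On both unit spheres the position vector field is a unit normal field.\<close>

definition position_field :: "real^3 \<Rightarrow> real^3" where
  "position_field p = p"

lemma position_normal_level_set:
  assumes "open_interval J" "smooth_curve_on J \<gamma>" "\<forall>u\<in>J. lorentz (\<gamma> u) (\<gamma> u) = e" "s \<in> J"
  shows "lorentz (\<gamma> s) (velocity \<gamma> s) = 0"
proof -
  have "((velocity ^^ 0) \<gamma>) differentiable (at s)"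
    using assms(2,4) unfolding smooth_curve_on_def by blast
  then have d: "(\<gamma> has_vector_derivative velocity \<gamma> s) (at s)"
    by (simp add: vector_derivative_works)
  have c: "((\<lambda>u. \<gamma> u $ i) has_real_derivative (velocity \<gamma> s $ i)) (at s)" for i
    using bounded_linear.has_vector_derivative[OF bounded_linear_vec_nth d]
    by (simp add: has_real_derivative_iff_has_vector_derivative)
  have 1: "((\<lambda>u. lorentz (\<gamma> u) (\<gamma> u)) has_real_derivative
      2 * lorentz (\<gamma> s) (velocity \<gamma> s)) (at s)"
    unfolding lorentz_def
    by (rule derivative_eq_intros c refl)+ (simp add: algebra_simps)
  have 2: "((\<lambda>u. e) has_real_derivative 0) (at s)" by simp
  have "((\<lambda>u. lorentz (\<gamma> u) (\<gamma> u)) has_real_derivative 0) (at s)"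
    by (rule DERIV_cong_ev[OF refl _ refl, THEN iffD2, OF _ 2])
      (use assms(1,3,4) in \<open>auto simp: open_interval_def eventually_nhds\<close>)
  with 1 show ?thesis by (metis DERIV_unique mult_eq_0_iff zero_neq_numeral)
qed

lemma unit_normal_lorentzian_sphere: "unit_normal_field lorentzian_sphere position_field"
  unfolding unit_normal_field_def
  by (auto simp: lorentzian_sphere_def position_field_def image_subset_iff
      intro: position_normal_level_set[where e = 1])

lemma unit_normal_hyperbolic_sphere: "unit_normal_field hyperbolic_sphere position_field"
  unfolding unit_normal_field_def
  by (auto simp: hyperbolic_sphere_def position_field_def image_subset_iff
      intro: position_normal_level_set[where e = "-1"])

lemma lorentz_bilinear:
  "lorentz (x + y) z = lorentz x z + lorentz y z"
  "lorentz z (x + y) = lorentz z x + lorentz z y"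
  "lorentz (x - y) z = lorentz x z - lorentz y z"
  "lorentz z (x - y) = lorentz z x - lorentz z y"
  "lorentz (r *\<^sub>R x) z = r * lorentz x z"
  "lorentz z (r *\<^sub>R x) = r * lorentz z x"
  "lorentz (- x) z = - lorentz x z"
  "lorentz z (- x) = - lorentz z x"
  by (simp_all add: lorentz_def algebra_simps)

lemma lorentz_commute: "lorentz x y = lorentz y x"
  by (simp add: lorentz_def algebra_simps)

lemma involute_binormal_spacelike_darboux_orthogonal:
  assumes "frenet_timelike_binormal I \<alpha> t n b \<kappa> \<tau>"
    and "angle_spacelike_darboux I (darboux t b \<kappa> \<tau>) \<kappa> \<tau> \<theta>" and "s \<in> I"
  shows "lorentz (involute_binormal_spacelike_darboux \<theta> t b s) (n s) = 0"
    and "lorentz (involute_binormal_spacelike_darboux \<theta> t b s) (velocity n s) = 0"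
proof -
  define w where "w = lorentz_norm (darboux t b \<kappa> \<tau> s)"
  have k: "\<kappa> s = w * sinh (\<theta> s)" "\<tau> s = w * cosh (\<theta> s)"
    using assms(2,3) by (simp_all add: angle_spacelike_darboux_def w_def)
  show "lorentz (involute_binormal_spacelike_darboux \<theta> t b s) (n s) = 0"
    and "lorentz (involute_binormal_spacelike_darboux \<theta> t b s) (velocity n s) = 0"
    using assms(1,3)
    by (auto simp: frenet_timelike_binormal_def involute_binormal_spacelike_darboux_def
        lorentz_bilinear lorentz_commute[of "b s" "t s"] lorentz_commute[of "b s" "n s"] k)
qed

lemma involute_binormal_timelike_darboux_orthogonal:
  assumes "frenet_timelike_binormal I \<alpha> t n b \<kappa> \<tau>"
    and "angle_timelike_darboux I (darboux t b \<kappa> \<tau>) \<kappa> \<tau> \<theta>" and "s \<in> I"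
  shows "lorentz (involute_binormal_timelike_darboux \<theta> t b s) (n s) = 0"
    and "lorentz (involute_binormal_timelike_darboux \<theta> t b s) (velocity n s) = 0"
proof -
  define w where "w = lorentz_norm (darboux t b \<kappa> \<tau> s)"
  have k: "\<kappa> s = w * cosh (\<theta> s)" "\<tau> s = w * sinh (\<theta> s)"
    using assms(2,3) by (simp_all add: angle_timelike_darboux_def w_def)
  show "lorentz (involute_binormal_timelike_darboux \<theta> t b s) (n s) = 0"
    and "lorentz (involute_binormal_timelike_darboux \<theta> t b s) (velocity n s) = 0"
    using assms(1,3)
    by (auto simp: frenet_timelike_binormal_def involute_binormal_timelike_darboux_def
        lorentz_bilinear lorentz_commute[of "b s" "t s"] lorentz_commute[of "b s" "n s"] k)
qed

end

theory Submission
  imports Defs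
begin

text \<open>Let \<gamma> and \<delta> be the vectors
  \<open>involute_binormal_spacelike_darboux \<theta> t b\<close> and
  \<open>involute_binormal_timelike_darboux \<theta> t b\<close>. They arise from \<open>- t\<close>
  and \<open>b\<close> by a hyperbolic rotation through \<theta>, so together with \<open>n\<close>
  they form an orthonormal frame for the Lorentzian metric. Since \<open>t'\<close> and
  \<open>b'\<close> are multiples of \<open>n\<close>, the derivative of each of \<gamma>, \<delta>
  is \<theta>' times the other plus a multiple of \<open>n\<close>
  (\<open>involute_binormals_derivatives\<close>). The defining relations of \<theta> cancel the
  \<open>n\<close> term for the one that is \<open>b*\<close>, and make it the norm of \<omega>, up
  to sign, for its partner.

  So \<open>b*\<close> moves only in the direction of its partner \<open>e\<close>. If a
  reparametrization \<beta> of \<open>b*\<close> is a geodesic, its acceleration is a multiple of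
  \<open>b*\<close>; the vanishing \<open>e\<close> and \<open>n\<close> components force a constant
  factor \<open>p\<close> in front of \<open>e\<close> and then, unless \<open>p = 0\<close>,
  vanishing norm of \<omega> (\<open>geodesic_in_adapted_frame\<close>). A constant \<beta> has zero
  acceleration and is the only escape. Otherwise \<kappa> and \<tau> vanish on all of
  \<open>I\<close>, which contradicts the strict inequality between their absolute values.

  Integral curves of the spray are geodesics, as the spray is normal to the sphere. Finally,
  vanishing \<kappa> makes \<alpha> a straight line, each of whose involutes collapses to a
  point.\<close>

section \<open>Smooth, constant and regular curves\<close>

lemma smooth_curve_on_has_vector_derivative:
  assumes "smooth_curve_on I \<gamma>" "s \<in> I"
  shows "(\<gamma> has_vector_derivative velocity \<gamma> s) (at s)"
proof -
  have "((velocity ^^ 0) \<gamma>) differentiable (at s)"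
    using assms unfolding smooth_curve_on_def by blast
  then show ?thesis by (simp add: vector_derivative_works)
qed

lemma smooth_curve_on_velocity:
  assumes "smooth_curve_on I \<gamma>"
  shows "smooth_curve_on I (velocity \<gamma>)"
  unfolding smooth_curve_on_def
proof (intro allI ballI)
  fix k s assume "s \<in> I"
  then have "((velocity ^^ Suc k) \<gamma>) differentiable (at s)"
    using assms unfolding smooth_curve_on_def by blast
  then show "((velocity ^^ k) (velocity \<gamma>)) differentiable (at s)"
    by (simp add: funpow_Suc_right del: funpow.simps)
qed

lemma constant_on_interval_if_zero_derivative:
  assumes "open_interval J"
    and "\<And>u. u \<in> J \<Longrightarrow> (f has_vector_derivative 0) (at u)"
  shows "f constant_on J"
proof -
  have "convex J"
    using assms(1) by (simp add: open_interval_def is_interval_convex)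
  then obtain c where "\<And>u. u \<in> J \<Longrightarrow> f u = c"
    using has_vector_derivative_zero_constant has_vector_derivative_at_within assms(2) by metis
  then show ?thesis by (auto simp: constant_on_def)
qed

lemma constant_on_open_imp_zero_velocity:
  assumes "open J" "f constant_on J" "u \<in> J"
  shows "velocity f u = 0"
proof -
  obtain c where c: "\<And>v. v \<in> J \<Longrightarrow> f v = c"
    using assms(2) by (auto simp: constant_on_def)
  have "(f has_vector_derivative 0) (at u)"
    by (rule has_vector_derivative_transform_within_open[OF has_vector_derivative_const assms(1,3)])
      (simp add: c)
  then show ?thesis by (rule vector_derivative_at)
qed

lemma regular_on_imp_nonconstant:
  assumes "open_interval J" "regular_on J \<beta>"
  shows "\<not> \<beta> constant_on J"
  using assms constant_on_open_imp_zero_velocity[of J \<beta>]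
  unfolding open_interval_def regular_on_def by blast

section \<open>Geodesics and integral curves of the spray\<close>

text \<open>The spray is a multiple of the position vector, which is the normal, so the acceleration
  has no tangential part. The induced connection multiplies twice by the sign of the normal, whose
  square is 1.\<close>

lemma geodesic_if_natural_lift_integral_curve:
  assumes "natural_lift_is_integral_curve M position_field J \<beta>"
    and "\<And>p. p \<in> M \<Longrightarrow> \<bar>lorentz p p\<bar> = 1"
  shows "geodesic_on M position_field J \<beta>"
  unfolding geodesic_on_def
proof (intro conjI ballI)
  show M: "\<beta> ` J \<subseteq> M"
    using assms(1) by (simp add: natural_lift_is_integral_curve_def)
  fix u assume u: "u \<in> J"
  obtain r where "acceleration \<beta> u = r *\<^sub>R \<beta> u"
    using assms(1) u
    by (auto simp: natural_lift_is_integral_curve_def geodesic_spray_def natural_lift_def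
        position_field_def)
  moreover have "lorentz (\<beta> u) (\<beta> u) * lorentz (\<beta> u) (\<beta> u) = 1"
    using assms(2)[of "\<beta> u"] M u by (metis abs_mult_self_eq image_subset_iff mult_1)
  ultimately show "covariant_acceleration position_field \<beta> u = 0"
    by (simp add: covariant_acceleration_def position_field_def lorentz_bilinear
        mult.left_commute)
qed

text \<open>In the orthogonal frame \<open>\<gamma>, e, n\<close> the curve \<open>\<beta> = \<gamma> \<circ> \<phi>\<close> has the acceleration
  \<open>p' e + p\<^sup>2 \<gamma> + p \<phi>' w n\<close> with \<open>p = (\<theta> \<circ> \<phi>)'\<close>. If \<open>\<beta>\<close> is a geodesic, then \<open>p\<close> is constant and
  \<open>p w = 0\<close>, and \<open>p = 0\<close> would make \<open>\<beta>\<close> constant.\<close>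

lemma geodesic_in_adapted_frame:
  fixes \<gamma> e n :: "real \<Rightarrow> real^3" and \<theta> w :: "real \<Rightarrow> real"
  assumes repar: "reparametrizes J \<beta> I \<gamma>"
    and \<theta>: "smooth_curve_on I \<theta>"
    and d\<gamma>: "\<And>s. s \<in> I \<Longrightarrow> (\<gamma> has_vector_derivative velocity \<theta> s *\<^sub>R e s) (at s)"
    and de: "\<And>s. s \<in> I \<Longrightarrow> (e has_vector_derivative velocity \<theta> s *\<^sub>R \<gamma> s + w s *\<^sub>R n s) (at s)"
    and unit: "\<And>s. s \<in> I \<Longrightarrow> lorentz (e s) (e s) \<noteq> 0 \<and> lorentz (n s) (n s) \<noteq> 0"
    and orth: "\<And>s. s \<in> I \<Longrightarrow>
      lorentz (\<gamma> s) (e s) = 0 \<and> lorentz (\<gamma> s) (n s) = 0 \<and> lorentz (e s) (n s) = 0"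
    and geo: "geodesic_on M position_field J \<beta>"
    and nonconst: "\<not> \<beta> constant_on J"
    and "s \<in> I"
  shows "w s = 0"
proof -
  obtain \<phi> where \<phi>: "smooth_curve_on J \<phi>" "regular_on J \<phi>" "\<phi> ` J = I" "\<And>u. u \<in> J \<Longrightarrow> \<beta> u = \<gamma> (\<phi> u)"
    and J: "open_interval J"
    using repar unfolding reparametrizes_def by auto
  have oJ: "open J" using J by (simp add: open_interval_def)
  define p where "p u = velocity \<phi> u * velocity \<theta> (\<phi> u)" for u
  have d\<phi>: "(\<phi> has_vector_derivative velocity \<phi> u) (at u)" if "u \<in> J" for u
    using smooth_curve_on_has_vector_derivative \<phi>(1) that by blast
  have chain: "((\<lambda>u. f (\<phi> u)) has_vector_derivative velocity \<phi> u *\<^sub>R D) (at u)"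
    if "u \<in> J" "(f has_vector_derivative D) (at (\<phi> u))" for f :: "real \<Rightarrow> 'a::real_normed_vector" and D u
    using vector_diff_chain_at[OF d\<phi>[OF that(1)] that(2)] by (simp add: o_def)
  \<comment> \<open>\<beta> agrees with \<gamma> composed with \<phi> only on \<open>J\<close>;
    openness of \<open>J\<close> carries the derivative over.\<close>
  have d\<beta>: "(\<beta> has_vector_derivative p u *\<^sub>R e (\<phi> u)) (at u)" if u: "u \<in> J" for u
  proof (rule has_vector_derivative_transform_within_open[OF _ oJ u])
    show "((\<lambda>u. \<gamma> (\<phi> u)) has_vector_derivative p u *\<^sub>R e (\<phi> u)) (at u)"
      using chain[OF u d\<gamma>] \<phi>(3) u by (auto simp: p_def)
  qed (simp add: \<phi>(4))
  \<comment> \<open>\<open>velocity p u\<close> is a genuine derivative only once \<open>p\<close>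
    is known to be differentiable; this is where second derivatives of \<phi> and \<theta>
    enter.\<close>
  have dp: "(p has_vector_derivative velocity p u) (at u)" if u: "u \<in> J" for u
  proof -
    have "(velocity \<phi> has_vector_derivative acceleration \<phi> u) (at u)"
      using smooth_curve_on_has_vector_derivative smooth_curve_on_velocity \<phi>(1) u by blast
    moreover have "((\<lambda>u. velocity \<theta> (\<phi> u)) has_vector_derivative
        velocity \<phi> u *\<^sub>R acceleration \<theta> (\<phi> u)) (at u)"
      using chain[OF u] smooth_curve_on_has_vector_derivative[OF smooth_curve_on_velocity[OF \<theta>]] \<phi>(3) u
      by blast
    ultimately have "p differentiable at u"
      unfolding p_def
      by (intro differentiable_mult) (auto intro: differentiableI_vector)
    then show ?thesis by (simp add: vector_derivative_works)
  qed
  have acc: "acceleration \<beta> u = velocity p u *\<^sub>R e (\<phi> u) + (p u * p u) *\<^sub>R \<gamma> (\<phi> u)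
      + (p u * velocity \<phi> u * w (\<phi> u)) *\<^sub>R n (\<phi> u)" if u: "u \<in> J" for u
  proof (rule vector_derivative_at, rule has_vector_derivative_transform_within_open[OF _ oJ u])
    have "((\<lambda>u. e (\<phi> u)) has_vector_derivative
        velocity \<phi> u *\<^sub>R (velocity \<theta> (\<phi> u) *\<^sub>R \<gamma> (\<phi> u) + w (\<phi> u) *\<^sub>R n (\<phi> u))) (at u)"
      using chain[OF u de] \<phi>(3) u by blast
    from has_vector_derivative_scaleR[OF _ this, of p "velocity p u"] dp[OF u]
    show "((\<lambda>u. p u *\<^sub>R e (\<phi> u)) has_vector_derivative velocity p u *\<^sub>R e (\<phi> u)
        + (p u * p u) *\<^sub>R \<gamma> (\<phi> u) + (p u * velocity \<phi> u * w (\<phi> u)) *\<^sub>R n (\<phi> u)) (at u)"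
      by (simp add: has_real_derivative_iff_has_vector_derivative p_def algebra_simps)
  qed (simp add: vector_derivative_at[OF d\<beta>])
  have flat: "velocity p u = 0 \<and> p u * velocity \<phi> u * w (\<phi> u) = 0" if u: "u \<in> J" for u
  proof -
    have I: "\<phi> u \<in> I" using \<phi>(3) u by blast
    have "covariant_acceleration position_field \<beta> u = 0"
      using geo u by (simp add: geodesic_on_def)
    then obtain r where r: "acceleration \<beta> u = r *\<^sub>R \<gamma> (\<phi> u)"
      by (auto simp: covariant_acceleration_def position_field_def \<phi>(4)[OF u])
    \<comment> \<open>Pairing with \<open>e\<close> and \<open>n\<close> reads off their
      coefficients in \<open>acc\<close>, because neither vector is null.\<close>
    have "lorentz (acceleration \<beta> u) (e (\<phi> u)) = 0" "lorentz (acceleration \<beta> u) (n (\<phi> u)) = 0"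
      unfolding r using orth[OF I] by (simp_all add: lorentz_bilinear)
    then show ?thesis
      unfolding acc[OF u] using orth[OF I] unit[OF I]
      by (auto simp: lorentz_bilinear lorentz_commute[of "n (\<phi> u)" "e (\<phi> u)"])
  qed
  obtain c where c: "\<And>u. u \<in> J \<Longrightarrow> p u = c"
    using constant_on_interval_if_zero_derivative[OF J, of p] dp flat
    by (metis constant_on_def)
  have "c \<noteq> 0"
    using constant_on_interval_if_zero_derivative[OF J, of \<beta>] d\<beta> c nonconst by force
  \<comment> \<open>Every point of \<open>I\<close> is reached by \<phi>, and both \<open>p\<close>
    and \<phi>' are nonzero there, so \<open>w\<close> is the factor that vanishes.\<close>
  obtain u where u: "u \<in> J" "s = \<phi> u" using \<phi>(3) \<open>s \<in> I\<close> by blast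
  then show ?thesis
    using flat[OF u(1)] c[OF u(1)] \<open>c \<noteq> 0\<close> \<phi>(2) by (auto simp: regular_on_def)
qed

section \<open>The moving frame of the two binormal formulas\<close>

text \<open>Differentiating the coefficients exchanges \<open>cosh\<close> and \<open>sinh\<close>,
  hence the two combinations; differentiating \<open>t\<close> and \<open>b\<close> contributes only
  multiples of \<open>n\<close>.\<close>

lemma has_vector_derivative_hyperbolic_combination:
  fixes t b :: "real \<Rightarrow> 'a::real_normed_vector"
  assumes "(\<theta> has_vector_derivative \<theta>') (at s)"
    and "(t has_vector_derivative \<kappa> *\<^sub>R n) (at s)" "(b has_vector_derivative \<tau> *\<^sub>R n) (at s)"
  shows "((\<lambda>s. - cosh (\<theta> s) *\<^sub>R t s + sinh (\<theta> s) *\<^sub>R b s) has_vector_derivative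
      \<theta>' *\<^sub>R (- sinh (\<theta> s) *\<^sub>R t s + cosh (\<theta> s) *\<^sub>R b s)
        + (sinh (\<theta> s) * \<tau> - cosh (\<theta> s) * \<kappa>) *\<^sub>R n) (at s)"
    and "((\<lambda>s. - sinh (\<theta> s) *\<^sub>R t s + cosh (\<theta> s) *\<^sub>R b s) has_vector_derivative
      \<theta>' *\<^sub>R (- cosh (\<theta> s) *\<^sub>R t s + sinh (\<theta> s) *\<^sub>R b s)
        + (cosh (\<theta> s) * \<tau> - sinh (\<theta> s) * \<kappa>) *\<^sub>R n) (at s)"
proof -
  have \<theta>: "(\<theta> has_real_derivative \<theta>') (at s)"
    using assms(1) by (simp add: has_real_derivative_iff_has_vector_derivative)
  have ch: "((\<lambda>s. cosh (\<theta> s)) has_real_derivative sinh (\<theta> s) * \<theta>') (at s)"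
    and sh: "((\<lambda>s. sinh (\<theta> s)) has_real_derivative cosh (\<theta> s) * \<theta>') (at s)"
    by (auto intro!: derivative_eq_intros \<theta>)
  show "((\<lambda>s. - cosh (\<theta> s) *\<^sub>R t s + sinh (\<theta> s) *\<^sub>R b s) has_vector_derivative
      \<theta>' *\<^sub>R (- sinh (\<theta> s) *\<^sub>R t s + cosh (\<theta> s) *\<^sub>R b s)
        + (sinh (\<theta> s) * \<tau> - cosh (\<theta> s) * \<kappa>) *\<^sub>R n) (at s)"
    by (rule has_vector_derivative_eq_rhs[OF has_vector_derivative_add[OF
          has_vector_derivative_scaleR[OF DERIV_minus[OF ch] assms(2)]
          has_vector_derivative_scaleR[OF sh assms(3)]]])
      (simp add: algebra_simps)
  show "((\<lambda>s. - sinh (\<theta> s) *\<^sub>R t s + cosh (\<theta> s) *\<^sub>R b s) has_vector_derivative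
      \<theta>' *\<^sub>R (- cosh (\<theta> s) *\<^sub>R t s + sinh (\<theta> s) *\<^sub>R b s)
        + (cosh (\<theta> s) * \<tau> - sinh (\<theta> s) * \<kappa>) *\<^sub>R n) (at s)"
    by (rule has_vector_derivative_eq_rhs[OF has_vector_derivative_add[OF
          has_vector_derivative_scaleR[OF DERIV_minus[OF sh] assms(2)]
          has_vector_derivative_scaleR[OF ch assms(3)]]])
      (simp add: algebra_simps)
qed

lemma frenet_derivatives:
  assumes "frenet_timelike_binormal I \<alpha> t n b \<kappa> \<tau>" "s \<in> I"
  shows "(\<alpha> has_vector_derivative t s) (at s)"
    and "(t has_vector_derivative \<kappa> s *\<^sub>R n s) (at s)"
    and "(b has_vector_derivative \<tau> s *\<^sub>R n s) (at s)"
  using assms smooth_curve_on_has_vector_derivative[of I _ s]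
  unfolding frenet_timelike_binormal_def by metis+

lemma frenet_orthogonality:
  assumes "frenet_timelike_binormal I \<alpha> t n b \<kappa> \<tau>" "s \<in> I"
  shows "lorentz (t s) (t s) = 1" "lorentz (n s) (n s) = 1" "lorentz (b s) (b s) = -1"
    "lorentz (t s) (n s) = 0" "lorentz (t s) (b s) = 0" "lorentz (n s) (b s) = 0"
    "lorentz (n s) (t s) = 0" "lorentz (b s) (t s) = 0" "lorentz (b s) (n s) = 0"
  using assms lorentz_commute unfolding frenet_timelike_binormal_def by metis+

text \<open>Both vectors are treated together because each serves in both cases: as
  \<open>b*\<close> in its own case and, up to sign, as the principal normal of the involute in the
  other.\<close>

lemma involute_binormals_orthogonality:
  fixes \<theta> :: "real \<Rightarrow> real"
  assumes "frenet_timelike_binormal I \<alpha> t n b \<kappa> \<tau>" "s \<in> I"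
  defines "\<gamma> \<equiv> involute_binormal_spacelike_darboux \<theta> t b"
    and "\<delta> \<equiv> involute_binormal_timelike_darboux \<theta> t b"
  shows "lorentz (\<gamma> s) (\<gamma> s) = 1" "lorentz (\<delta> s) (\<delta> s) = -1"
    "lorentz (\<gamma> s) (\<delta> s) = 0" "lorentz (\<delta> s) (\<gamma> s) = 0"
    "lorentz (\<gamma> s) (n s) = 0" "lorentz (\<delta> s) (n s) = 0"
proof -
  have "cosh (\<theta> s) * cosh (\<theta> s) - sinh (\<theta> s) * sinh (\<theta> s) = 1"
    using hyperbolic_pythagoras[of "\<theta> s"] by (simp add: power2_eq_square)
  then show "lorentz (\<gamma> s) (\<gamma> s) = 1" "lorentz (\<delta> s) (\<delta> s) = -1"
    "lorentz (\<gamma> s) (\<delta> s) = 0" "lorentz (\<delta> s) (\<gamma> s) = 0"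
    "lorentz (\<gamma> s) (n s) = 0" "lorentz (\<delta> s) (n s) = 0"
    by (simp_all add: \<gamma>_def \<delta>_def involute_binormal_spacelike_darboux_def
        involute_binormal_timelike_darboux_def lorentz_bilinear frenet_orthogonality[OF assms(1,2)])
qed

lemma involute_binormals_derivatives:
  assumes "frenet_timelike_binormal I \<alpha> t n b \<kappa> \<tau>" "smooth_curve_on I \<theta>" "s \<in> I"
  defines "\<gamma> \<equiv> involute_binormal_spacelike_darboux \<theta> t b"
    and "\<delta> \<equiv> involute_binormal_timelike_darboux \<theta> t b"
  shows "(\<gamma> has_vector_derivative velocity \<theta> s *\<^sub>R \<delta> s
      + (sinh (\<theta> s) * \<tau> s - cosh (\<theta> s) * \<kappa> s) *\<^sub>R n s) (at s)"
    and "(\<delta> has_vector_derivative velocity \<theta> s *\<^sub>R \<gamma> s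
      + (cosh (\<theta> s) * \<tau> s - sinh (\<theta> s) * \<kappa> s) *\<^sub>R n s) (at s)"
  using has_vector_derivative_hyperbolic_combination[OF
      smooth_curve_on_has_vector_derivative[OF assms(2,3)] frenet_derivatives(2,3)[OF assms(1,3)]]
  unfolding \<gamma>_def \<delta>_def involute_binormal_spacelike_darboux_def
    involute_binormal_timelike_darboux_def .

section \<open>A nonconstant geodesic indicatrix forces zero curvature and torsion\<close>

text \<open>The adapted frame has the timelike formula as \<open>e\<close>. The relations for
  \<theta> cancel the \<open>n\<close> term of the derivative of \<open>b*\<close>, and the
  hyperbolic Pythagorean identity reduces that of \<open>e'\<close> to the norm \<open>w\<close> of
  \<omega>, a common factor of \<kappa> and \<tau>.\<close>

lemma geodesic_binormal_spacelike_darboux: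
  assumes fr: "frenet_timelike_binormal I \<alpha> t n b \<kappa> \<tau>"
    and angle: "angle_spacelike_darboux I (darboux t b \<kappa> \<tau>) \<kappa> \<tau> \<theta>"
    and repar: "reparametrizes J \<beta> I (involute_binormal_spacelike_darboux \<theta> t b)"
    and geo: "geodesic_on M position_field J \<beta>"
    and nonconst: "\<not> \<beta> constant_on J"
    and "s \<in> I"
  shows "\<kappa> s = 0 \<and> \<tau> s = 0"
proof -
  define w where "w s = lorentz_norm (darboux t b \<kappa> \<tau> s)" for s
  have \<theta>: "smooth_curve_on I \<theta>"
    and k: "\<And>s. s \<in> I \<Longrightarrow> \<kappa> s = w s * sinh (\<theta> s) \<and> \<tau> s = w s * cosh (\<theta> s)"
    using angle by (auto simp: angle_spacelike_darboux_def w_def)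
  have "w s = 0"
  proof (rule geodesic_in_adapted_frame[OF repar \<theta> _ _ _ _ geo nonconst \<open>s \<in> I\<close>])
    fix s assume s: "s \<in> I"
    have "cosh (\<theta> s) * \<tau> s - sinh (\<theta> s) * \<kappa> s
        = w s * (cosh (\<theta> s) * cosh (\<theta> s) - sinh (\<theta> s) * sinh (\<theta> s))"
      by (simp add: k[OF s] algebra_simps)
    also have "\<dots> = w s"
      using hyperbolic_pythagoras[of "\<theta> s"] by (simp add: power2_eq_square)
    finally have "cosh (\<theta> s) * \<tau> s - sinh (\<theta> s) * \<kappa> s = w s" .
    moreover have "sinh (\<theta> s) * \<tau> s - cosh (\<theta> s) * \<kappa> s = 0"
      by (simp add: k[OF s])
    ultimately show "(involute_binormal_spacelike_darboux \<theta> t b has_vector_derivative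
        velocity \<theta> s *\<^sub>R involute_binormal_timelike_darboux \<theta> t b s) (at s)"
      and "(involute_binormal_timelike_darboux \<theta> t b has_vector_derivative
        velocity \<theta> s *\<^sub>R involute_binormal_spacelike_darboux \<theta> t b s + w s *\<^sub>R n s) (at s)"
      using involute_binormals_derivatives[OF fr \<theta> s] by auto
  qed (simp_all add: involute_binormals_orthogonality[OF fr] frenet_orthogonality[OF fr])
  then show ?thesis using k[OF \<open>s \<in> I\<close>] by simp
qed

text \<open>The two binormal formulas exchange roles, and so do \<open>sinh\<close> and
  \<open>cosh\<close> in \<kappa> and \<tau>; the surviving \<open>n\<close> coefficient is now
  \<open>- w\<close>.\<close>

lemma geodesic_binormal_timelike_darboux:
  assumes fr: "frenet_timelike_binormal I \<alpha> t n b \<kappa> \<tau>"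
    and angle: "angle_timelike_darboux I (darboux t b \<kappa> \<tau>) \<kappa> \<tau> \<theta>"
    and repar: "reparametrizes J \<beta> I (involute_binormal_timelike_darboux \<theta> t b)"
    and geo: "geodesic_on M position_field J \<beta>"
    and nonconst: "\<not> \<beta> constant_on J"
    and "s \<in> I"
  shows "\<kappa> s = 0 \<and> \<tau> s = 0"
proof -
  define w where "w s = lorentz_norm (darboux t b \<kappa> \<tau> s)" for s
  have \<theta>: "smooth_curve_on I \<theta>"
    and k: "\<And>s. s \<in> I \<Longrightarrow> \<kappa> s = w s * cosh (\<theta> s) \<and> \<tau> s = w s * sinh (\<theta> s)"
    using angle by (auto simp: angle_timelike_darboux_def w_def)
  have "- w s = 0"
  proof (rule geodesic_in_adapted_frame[OF repar \<theta> _ _ _ _ geo nonconst \<open>s \<in> I\<close>])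
    fix s assume s: "s \<in> I"
    have "sinh (\<theta> s) * \<tau> s - cosh (\<theta> s) * \<kappa> s
        = - w s * (cosh (\<theta> s) * cosh (\<theta> s) - sinh (\<theta> s) * sinh (\<theta> s))"
      by (simp add: k[OF s] algebra_simps)
    also have "\<dots> = - w s"
      using hyperbolic_pythagoras[of "\<theta> s"] by (simp add: power2_eq_square)
    finally have "sinh (\<theta> s) * \<tau> s - cosh (\<theta> s) * \<kappa> s = - w s" .
    moreover have "cosh (\<theta> s) * \<tau> s - sinh (\<theta> s) * \<kappa> s = 0"
      by (simp add: k[OF s])
    ultimately show "(involute_binormal_timelike_darboux \<theta> t b has_vector_derivative
        velocity \<theta> s *\<^sub>R involute_binormal_spacelike_darboux \<theta> t b s) (at s)"
      and "(involute_binormal_spacelike_darboux \<theta> t b has_vector_derivative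
        velocity \<theta> s *\<^sub>R involute_binormal_timelike_darboux \<theta> t b s + - w s *\<^sub>R n s) (at s)"
      using involute_binormals_derivatives[OF fr \<theta> s] by auto
  qed (simp_all add: involute_binormals_orthogonality[OF fr] frenet_orthogonality[OF fr])
  then show ?thesis using k[OF \<open>s \<in> I\<close>] by simp
qed

section \<open>Straight evolutes\<close>

text \<open>With \<kappa> zero the tangent is a constant \<open>v\<close>, and then \<alpha> minus
  \<open>s *\<^sub>R v\<close> has zero derivative.\<close>

lemma frenet_zero_curvature_affine:
  assumes fr: "frenet_timelike_binormal I \<alpha> t n b \<kappa> \<tau>"
    and zero: "\<And>s. s \<in> I \<Longrightarrow> \<kappa> s = 0"
  obtains a v where "\<And>s. s \<in> I \<Longrightarrow> \<alpha> s = a + s *\<^sub>R v" "\<And>s. s \<in> I \<Longrightarrow> velocity \<alpha> s = v"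
proof -
  have I: "open_interval I" using fr by (simp add: frenet_timelike_binormal_def)
  have "t constant_on I"
    using constant_on_interval_if_zero_derivative[OF I, of t] frenet_derivatives(2)[OF fr] zero
    by force
  then obtain v where v: "\<And>s. s \<in> I \<Longrightarrow> t s = v" by (auto simp: constant_on_def)
  have "((\<lambda>s. \<alpha> s - s *\<^sub>R v) has_vector_derivative 0) (at s)" if "s \<in> I" for s
    using frenet_derivatives(1)[OF fr that] v[OF that]
    by (auto intro!: derivative_eq_intros)
  then have "(\<lambda>s. \<alpha> s - s *\<^sub>R v) constant_on I"
    by (rule constant_on_interval_if_zero_derivative[OF I])
  then obtain a where a: "\<And>s. s \<in> I \<Longrightarrow> \<alpha> s - s *\<^sub>R v = a" by (auto simp: constant_on_def)
  show ?thesis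
  proof (rule that)
    show "\<alpha> s = a + s *\<^sub>R v" if "s \<in> I" for s
      using a[OF that] by (simp add: algebra_simps)
    show "velocity \<alpha> s = v" if "s \<in> I" for s
      using v[OF that] vector_derivative_at[OF frenet_derivatives(1)[OF fr that]] by simp
  qed
qed

lemma frenet_zero_curvature_collinear:
  assumes "frenet_timelike_binormal I \<alpha> t n b \<kappa> \<tau>" "\<And>s. s \<in> I \<Longrightarrow> \<kappa> s = 0"
  shows "collinear (\<alpha> ` I)"
proof -
  obtain a v where a: "\<And>s. s \<in> I \<Longrightarrow> \<alpha> s = a + s *\<^sub>R v"
    using frenet_zero_curvature_affine[OF assms] by metis
  show ?thesis unfolding collinear_def
  proof (intro exI[of _ v] ballI)
    fix x y assume "x \<in> \<alpha> ` I" "y \<in> \<alpha> ` I"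
    then obtain s r where "x = a + s *\<^sub>R v" "y = a + r *\<^sub>R v" using a by auto
    then have "x - y = (s - r) *\<^sub>R v" by (simp add: algebra_simps)
    then show "\<exists>c. x - y = c *\<^sub>R v" ..
  qed
qed

text \<open>The motion along the line and the term \<open>- s *\<^sub>R v\<close> of the involute
  cancel, leaving the single point \<open>a + c *\<^sub>R v\<close>, which a couple
  excludes.\<close>

lemma frenet_zero_curvature_no_involute:
  assumes "frenet_timelike_binormal I \<alpha> t n b \<kappa> \<tau>" "\<And>s. s \<in> I \<Longrightarrow> \<kappa> s = 0"
  shows "\<not> involute_evolute_couple I \<alpha> \<alpha>s"
proof
  assume "involute_evolute_couple I \<alpha> \<alpha>s"
  then obtain c where c: "\<And>s. s \<in> I \<Longrightarrow> \<alpha>s s = \<alpha> s + (c - s) *\<^sub>R velocity \<alpha> s"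
    and nc: "\<not> \<alpha>s constant_on I"
    unfolding involute_evolute_couple_def by blast
  obtain a v where "\<And>s. s \<in> I \<Longrightarrow> \<alpha> s = a + s *\<^sub>R v" "\<And>s. s \<in> I \<Longrightarrow> velocity \<alpha> s = v"
    using frenet_zero_curvature_affine[OF assms] by metis
  with c have "\<alpha>s s = a + c *\<^sub>R v" if "s \<in> I" for s
    using that by (simp add: algebra_simps)
  with nc show False by (auto simp: constant_on_def)
qed

section \<open>The two spheres and the degenerate evolute\<close>

theorem mainTheorem3:
  fixes \<alpha> \<alpha>s \<beta> t n b :: "real \<Rightarrow> real^3"
    and \<kappa> \<tau> \<theta> :: "real \<Rightarrow> real"
    and I J :: "real set"
  assumes frenet: "frenet_timelike_binormal I \<alpha> t n b \<kappa> \<tau>"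
  shows
    "(angle_spacelike_darboux I (darboux t b \<kappa> \<tau>) \<kappa> \<tau> \<theta> \<and>
      reparametrizes J \<beta> I (involute_binormal_spacelike_darboux \<theta> t b) \<longrightarrow>
        \<beta> ` J \<subseteq> lorentzian_sphere \<and>
        ((\<forall>s\<in>I. spacelike (darboux t b \<kappa> \<tau> s) \<and> \<bar>\<kappa> s\<bar> < \<bar>\<tau> s\<bar>) \<and>
         involute_evolute_couple I \<alpha> \<alpha>s \<and> \<not> \<beta> constant_on J \<longrightarrow>
           \<not> geodesic_on lorentzian_sphere position_field J \<beta> \<and>
           \<not> natural_lift_is_integral_curve lorentzian_sphere position_field J \<beta>) \<and>
        (regular_on J \<beta> \<and> geodesic_on lorentzian_sphere position_field J \<beta> \<longrightarrow>
           (\<forall>s\<in>I. \<kappa> s = 0 \<and> \<tau> s = 0)))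
     \<and>
     (angle_timelike_darboux I (darboux t b \<kappa> \<tau>) \<kappa> \<tau> \<theta> \<and>
      reparametrizes J \<beta> I (involute_binormal_timelike_darboux \<theta> t b) \<longrightarrow>
        \<beta> ` J \<subseteq> hyperbolic_sphere \<and>
        ((\<forall>s\<in>I. timelike (darboux t b \<kappa> \<tau> s) \<and> \<bar>\<kappa> s\<bar> > \<bar>\<tau> s\<bar>) \<and>
         involute_evolute_couple I \<alpha> \<alpha>s \<and> \<not> \<beta> constant_on J \<longrightarrow>
           \<not> geodesic_on hyperbolic_sphere position_field J \<beta> \<and>
           \<not> natural_lift_is_integral_curve hyperbolic_sphere position_field J \<beta>) \<and>
        (regular_on J \<beta> \<and> geodesic_on hyperbolic_sphere position_field J \<beta> \<longrightarrow>
           (\<forall>s\<in>I. \<kappa> s = 0 \<and> \<tau> s = 0)))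
     \<and>
     ((\<forall>s\<in>I. \<kappa> s = 0 \<and> \<tau> s = 0) \<longrightarrow>
        collinear (\<alpha> ` I) \<and> \<not> involute_evolute_couple I \<alpha> \<alpha>s)"
proof (intro conjI impI; (elim conjE)?)
  have frI: "open_interval I" using frenet by (simp add: frenet_timelike_binormal_def)
  then have ne: "I \<noteq> {}" by (simp add: open_interval_def)
  {
    assume angle: "angle_spacelike_darboux I (darboux t b \<kappa> \<tau>) \<kappa> \<tau> \<theta>"
      and repar: "reparametrizes J \<beta> I (involute_binormal_spacelike_darboux \<theta> t b)"
    note zero = geodesic_binormal_spacelike_darboux[OF frenet angle repar]
    show "\<beta> ` J \<subseteq> lorentzian_sphere"
      using repar involute_binormals_orthogonality(1)[OF frenet]
      by (auto simp: reparametrizes_def lorentzian_sphere_def)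
    {
      assume "\<forall>s\<in>I. spacelike (darboux t b \<kappa> \<tau> s) \<and> \<bar>\<kappa> s\<bar> < \<bar>\<tau> s\<bar>" and "\<not> \<beta> constant_on J"
      \<comment> \<open>A geodesic would give \<kappa> and \<tau> zero at some point of the nonempty
        \<open>I\<close>, against the strict inequality there.\<close>
      then show "\<not> geodesic_on lorentzian_sphere position_field J \<beta>"
        using zero ne by fastforce
      then show "\<not> natural_lift_is_integral_curve lorentzian_sphere position_field J \<beta>"
        using geodesic_if_natural_lift_integral_curve[of lorentzian_sphere J \<beta>]
        by (auto simp: lorentzian_sphere_def)
    }
    assume "regular_on J \<beta>" and "geodesic_on lorentzian_sphere position_field J \<beta>"
    \<comment> \<open>Regularity supplies the nonconstancy that \<open>zero\<close> requires, as
      \<open>J\<close> is open and nonempty.\<close>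
    then show "\<forall>s\<in>I. \<kappa> s = 0 \<and> \<tau> s = 0"
      using zero repar regular_on_imp_nonconstant unfolding reparametrizes_def by blast
  }
  {
    assume angle: "angle_timelike_darboux I (darboux t b \<kappa> \<tau>) \<kappa> \<tau> \<theta>"
      and repar: "reparametrizes J \<beta> I (involute_binormal_timelike_darboux \<theta> t b)"
    note zero = geodesic_binormal_timelike_darboux[OF frenet angle repar]
    show "\<beta> ` J \<subseteq> hyperbolic_sphere"
      using repar involute_binormals_orthogonality(2)[OF frenet]
      by (auto simp: reparametrizes_def hyperbolic_sphere_def)
    {
      assume "\<forall>s\<in>I. timelike (darboux t b \<kappa> \<tau> s) \<and> \<bar>\<kappa> s\<bar> > \<bar>\<tau> s\<bar>" and "\<not> \<beta> constant_on J"
      then show "\<not> geodesic_on hyperbolic_sphere position_field J \<beta>"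
        using zero ne by fastforce
      then show "\<not> natural_lift_is_integral_curve hyperbolic_sphere position_field J \<beta>"
        using geodesic_if_natural_lift_integral_curve[of hyperbolic_sphere J \<beta>]
        by (auto simp: hyperbolic_sphere_def)
    }
    assume "regular_on J \<beta>" and "geodesic_on hyperbolic_sphere position_field J \<beta>"
    then show "\<forall>s\<in>I. \<kappa> s = 0 \<and> \<tau> s = 0"
      using zero repar regular_on_imp_nonconstant unfolding reparametrizes_def by blast
  }
  assume "\<forall>s\<in>I. \<kappa> s = 0 \<and> \<tau> s = 0"
  then have zero: "\<And>s. s \<in> I \<Longrightarrow> \<kappa> s = 0" by blast
  show "collinear (\<alpha> ` I)"
    by (rule frenet_zero_curvature_collinear[OF frenet zero])
  show "\<not> involute_evolute_couple I \<alpha> \<alpha>s"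
    by (rule frenet_zero_curvature_no_involute[OF frenet zero])
qed

end
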